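(* For every $N\ge1$, let $\mathrm{AND}:\{0,1\}^N\to\{0,1\}$ be $\mathrm{AND}(X)=x_0\wedge\cdots\wedge x_{N-1}$. Then $Q_E(\mathrm{AND})=N$ and $Q_0(\mathrm{AND})=N$.
   Context: Quantum networks: the input $X=(x_0,\ldots,x_{N-1})\in\{0,1\}^N$ is given as a black-box. A quantum network with $T$ queries acts on $m$ qubits (for some $m$) and is a sequence of unitary transformations $U_0,O,U_1,O,\ldots,U_{T-1},O,U_T$ applied in this order to the initial state $|0\rangle$, where the $U_j$ are arbitrary unitaries on $m$ qubits not depending on $X$, and the query $O$ (depending on $X$) maps each basis state $|i,b,z\rangle$ to $|i,b\oplus x_i,z\rangle$; here $i$ consists of $\lceil\log_2 N\rceil$ bits, $b$ is one bit, and $z$ consists of the remaining $m-\lceil\log_2 N\rceil-1$ bits (if $i\ge N$, the query leaves the basis state unchanged). Exact computation: the output is the value obtained by measuring the rightmost bit of the final state in the computational basis; the network computes $f$ exactly if for every $X\in\{0,1\}^N$ the output equals $f(X)$ with certainty. Zero-error computation: the output is obtained by measuring the two rightmost bits of the final state. If the first of these two bits is 0 the answer is "inconclusive"; otherwise the second bit is the answer. The network computes $f$ with zero error if for every $X\in\{0,1\}^N$ the answer, whenever it is not "inconclusive", equals $f(X)$ with certainty, and the probability of "inconclusive" is less than $1/2$. $Q_E(f)$ and $Q_0(f)$ are the minimum $T$ such that some quantum network with $T$ queries computes $f$ exactly, respectively with zero error. *)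

theory Defs
  imports
    "Jordan_Normal_Form.Schur_Decomposition"
    "HOL-Library.Log_Nat"
    "HOL-Library.Extended_Nat"
begin

(* Inputs X in {0,1}^N are Boolean lists of length N.

   The basis state |k_1 ... k_m> is the unit vector whose index is the number with binary
   expansion k_1 ... k_m, so the rightmost qubit is bit 0 of the index. For |i,b,z> with
   n = ceillog2 N bits in i, the qubit b is therefore bit m - n - 1 of the index, and i is the
   index shifted right by m - n. *)

definition unitary_mat :: "nat \<Rightarrow> complex mat \<Rightarrow> bool" where
  "unitary_mat d U \<longleftrightarrow>
     U \<in> carrier_mat d d \<and> mat_adjoint U * U = 1\<^sub>m d \<and> U * mat_adjoint U = 1\<^sub>m d"

definition query_index :: "nat \<Rightarrow> bool list \<Rightarrow> nat \<Rightarrow> nat" where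
  "query_index m X k =
     (let n = ceillog2 (length X); i = drop_bit (m - n) k
      in if i < length X \<and> X ! i then flip_bit (m - n - 1) k else k)"

definition query_mat :: "nat \<Rightarrow> bool list \<Rightarrow> complex mat" where
  "query_mat m X = mat (2 ^ m) (2 ^ m) (\<lambda>(r, c). of_bool (r = query_index m X c))"

definition quantum_network :: "nat \<Rightarrow> nat \<Rightarrow> nat \<Rightarrow> (nat \<Rightarrow> complex mat) \<Rightarrow> bool" where
  "quantum_network N T m U \<longleftrightarrow>
     ceillog2 N + 1 \<le> m \<and> (\<forall>j\<le>T. unitary_mat (2 ^ m) (U j))"

fun network_state :: "nat \<Rightarrow> (nat \<Rightarrow> complex mat) \<Rightarrow> bool list \<Rightarrow> nat \<Rightarrow> complex vec" where
  "network_state m U X 0 = U 0 *\<^sub>v unit_vec (2 ^ m) 0"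
| "network_state m U X (Suc t) = U (Suc t) *\<^sub>v (query_mat m X *\<^sub>v network_state m U X t)"

(* Probability that a measurement of v in the computational basis gives an index satisfying P. *)
definition measure_prob :: "complex vec \<Rightarrow> (nat \<Rightarrow> bool) \<Rightarrow> real" where
  "measure_prob v P = (\<Sum>k | k < dim_vec v \<and> P k. (cmod (v $ k))\<^sup>2)"

definition computes_exactly ::
  "nat \<Rightarrow> nat \<Rightarrow> nat \<Rightarrow> (nat \<Rightarrow> complex mat) \<Rightarrow> (bool list \<Rightarrow> bool) \<Rightarrow> bool" where
  "computes_exactly N T m U f \<longleftrightarrow>
     (\<forall>X. length X = N \<longrightarrow>
        measure_prob (network_state m U X T) (\<lambda>k. bit k 0 = f X) = 1)"

(* The first (left) of the two rightmost qubits is bit 1 and the second one is bit 0; hence m has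
   to be at least 2, which quantum_network alone does not give when N = 1. *)
definition computes_zero_error ::
  "nat \<Rightarrow> nat \<Rightarrow> nat \<Rightarrow> (nat \<Rightarrow> complex mat) \<Rightarrow> (bool list \<Rightarrow> bool) \<Rightarrow> bool" where
  "computes_zero_error N T m U f \<longleftrightarrow>
     2 \<le> m \<and>
     (\<forall>X. length X = N \<longrightarrow>
        measure_prob (network_state m U X T) (\<lambda>k. bit k 1 \<and> bit k 0 \<noteq> f X) = 0 \<and>
        measure_prob (network_state m U X T) (\<lambda>k. \<not> bit k 1) < 1 / 2)"

(* Minimum in the extended naturals: infinity if there is no such network at all. *)
definition Q_E :: "nat \<Rightarrow> (bool list \<Rightarrow> bool) \<Rightarrow> enat" where
  "Q_E N f = (INF T\<in>{T. \<exists>m U. quantum_network N T m U \<and> computes_exactly N T m U f}. enat T)"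

definition Q_0 :: "nat \<Rightarrow> (bool list \<Rightarrow> bool) \<Rightarrow> enat" where
  "Q_0 N f = (INF T\<in>{T. \<exists>m U. quantum_network N T m U \<and> computes_zero_error N T m U f}. enat T)"

definition AND :: "bool list \<Rightarrow> bool" where
  "AND X \<longleftrightarrow> (\<forall>j<length X. X ! j)"

end

theory Submission
  imports Defs
begin

text \<open>Every amplitude after \<open>T\<close> queries is a multilinear polynomial of degree at most
  \<open>T\<close> in \<open>X\<close>, since a query replaces the amplitude \<open>v\<^sub>k\<close> by
  \<open>v\<^sub>k + x\<^sub>i (v\<^bsub>k'\<^esub> - v\<^sub>k)\<close>, where \<open>k'\<close> is \<open>k\<close> with the query bit flipped. Pairing a
  polynomial of degree less than \<open>N\<close> with the parity character of \<open>{0,1}\<^sup>N\<close> gives \<open>0\<close>.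
  A network for AND, exact or with zero error, has an amplitude that is non-zero at
  \<open>1\<^sup>N\<close> only, for which this pairing does not vanish; hence \<open>T \<ge> N\<close>. Conversely, \<open>N\<close>
  queries suffice to read the whole input by a classical reversible computation.\<close>

section \<open>Queries as permutations of the basis\<close>

lemma query_index_less:
  assumes "ceillog2 (length X) + 1 \<le> m" and "k < 2 ^ m"
  shows "query_index m X k < 2 ^ m"
proof -
  have "flip_bit (m - ceillog2 (length X) - 1) k < 2 ^ m"
  proof -
    have "\<not> m \<le> m - ceillog2 (length X) - 1" using assms(1) by linarith
    moreover have "take_bit m k = k" using assms(2) by (simp add: take_bit_nat_eq_self)
    ultimately have "take_bit m (flip_bit (m - ceillog2 (length X) - 1) k)
      = flip_bit (m - ceillog2 (length X) - 1) k"
      by (simp add: take_bit_flip_bit_eq)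
    thus ?thesis by (metis take_bit_nat_less_exp)
  qed
  thus ?thesis using assms by (simp add: query_index_def Let_def)
qed

lemma query_index_query_index:
  assumes "ceillog2 (length X) + 1 \<le> m"
  shows "query_index m X (query_index m X k) = k"
proof -
  let ?a = "m - ceillog2 (length X)"
  \<comment> \<open>The flipped bit lies just below the bits of i, so i survives. For m at most
    \<open>ceillog2 (length X)\<close>, truncated subtraction would instead flip bit 0 of i
    itself.\<close>
  have "drop_bit ?a (flip_bit (?a - 1) k) = drop_bit ?a k"
    using assms by (intro bit_eqI) (auto simp: bit_simps)
  moreover have "flip_bit (?a - 1) (flip_bit (?a - 1) k) = k"
    by (rule bit_eqI) (auto simp: bit_simps)
  ultimately show ?thesis by (auto simp: query_index_def Let_def)
qed

lemma dim_query_mat: "dim_row (query_mat m X) = 2 ^ m" "dim_col (query_mat m X) = 2 ^ m"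
  by (simp_all add: query_mat_def)

text \<open>Row k has its only 1 in the column that the query sends to k; as the query is an
  involution, that column is \<open>query_index m X k\<close>.\<close>

lemma index_query_mat_mult:
  assumes "ceillog2 (length X) + 1 \<le> m" and "dim_vec v = 2 ^ m" and "k < 2 ^ m"
  shows "(query_mat m X *\<^sub>v v) $ k = v $ query_index m X k"
proof -
  have "(query_mat m X *\<^sub>v v) $ k
      = (\<Sum>c\<in>{0..<2 ^ m}. of_bool (k = query_index m X c) * v $ c)"
    using assms by (simp add: query_mat_def scalar_prod_def)
  also have "\<dots> = (\<Sum>c\<in>{0..<2 ^ m}. if c = query_index m X k then v $ c else 0)"
    using query_index_query_index[OF assms(1)] by (intro sum.cong) auto
  also have "\<dots> = v $ query_index m X k"
    using query_index_less[OF assms(1,3)] by simp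
  finally show ?thesis .
qed

section \<open>Preservation of the norm\<close>

lemma dim_mat_adjoint:
  "dim_row (mat_adjoint A) = dim_col A" "dim_col (mat_adjoint A) = dim_row A"
  by (simp_all add: mat_adjoint_def)

lemma index_mat_adjoint:
  assumes "A \<in> carrier_mat d d" "i < d" "j < d"
  shows "mat_adjoint A $$ (i, j) = conjugate (A $$ (j, i))"
  using assms by (simp add: mat_adjoint_def mat_of_rows_def)

lemma measure_prob_True_eq_cscalar_prod:
  "complex_of_real (measure_prob v (\<lambda>_. True)) = v \<bullet>c v"
proof -
  have "{k. k < dim_vec v} = {0..<dim_vec v}" by auto
  thus ?thesis
    by (simp add: measure_prob_def scalar_prod_def complex_norm_square del: of_real_power)
qed

lemma measure_prob_True_unitary:
  assumes "unitary_mat d U" and "dim_vec v = d"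
  shows "measure_prob (U *\<^sub>v v) (\<lambda>_. True) = measure_prob v (\<lambda>_. True)"
proof -
  from assms(1) have U: "U \<in> carrier_mat d d" and UU: "mat_adjoint U * U = 1\<^sub>m d"
    by (auto simp: unitary_mat_def)
  \<comment> \<open>The identity \<open>UU\<close> read entrywise: the columns of \<open>U\<close>
    are orthonormal.\<close>
  have orth: "(\<Sum>k\<in>{0..<d}. U $$ (k, i) * cnj (U $$ (k, j))) = of_bool (i = j)"
    if "i < d" "j < d" for i j
  proof -
    have "(mat_adjoint U * U) $$ (j, i) = (\<Sum>k\<in>{0..<d}. mat_adjoint U $$ (j, k) * U $$ (k, i))"
      using U that by (simp add: scalar_prod_def dim_mat_adjoint)
    also have "\<dots> = (\<Sum>k\<in>{0..<d}. U $$ (k, i) * cnj (U $$ (k, j)))"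
      using U that by (intro sum.cong) (auto simp: index_mat_adjoint)
    finally show ?thesis using that UU by auto
  qed
  have "(U *\<^sub>v v) \<bullet>c (U *\<^sub>v v) = (\<Sum>k\<in>{0..<d}. (\<Sum>i\<in>{0..<d}. U $$ (k, i) * v $ i) *
      cnj (\<Sum>j\<in>{0..<d}. U $$ (k, j) * v $ j))"
    using U assms(2) by (simp add: scalar_prod_def)
  also have "\<dots> = (\<Sum>k\<in>{0..<d}. \<Sum>i\<in>{0..<d}. \<Sum>j\<in>{0..<d}.
      v $ i * cnj (v $ j) * (U $$ (k, i) * cnj (U $$ (k, j))))"
    by (simp add: sum_product mult_ac)
  also have "\<dots> = (\<Sum>i\<in>{0..<d}. \<Sum>k\<in>{0..<d}. \<Sum>j\<in>{0..<d}.
      v $ i * cnj (v $ j) * (U $$ (k, i) * cnj (U $$ (k, j))))"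
    by (rule sum.swap)
  also have "\<dots> = (\<Sum>i\<in>{0..<d}. \<Sum>j\<in>{0..<d}. \<Sum>k\<in>{0..<d}.
      v $ i * cnj (v $ j) * (U $$ (k, i) * cnj (U $$ (k, j))))"
    by (intro sum.cong refl sum.swap)
  also have "\<dots> = (\<Sum>i\<in>{0..<d}. \<Sum>j\<in>{0..<d}. v $ i * cnj (v $ j) * of_bool (i = j))"
    by (simp add: sum_distrib_left[symmetric] orth)
  also have "\<dots> = (\<Sum>i\<in>{0..<d}. \<Sum>j\<in>{0..<d}. if j = i then v $ i * cnj (v $ j) else 0)"
    by (intro sum.cong) auto
  also have "\<dots> = v \<bullet>c v"
    using assms(2) by (simp add: scalar_prod_def)
  finally show ?thesis
    by (simp flip: measure_prob_True_eq_cscalar_prod)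
qed

lemma measure_prob_True_query:
  assumes "ceillog2 (length X) + 1 \<le> m" and "dim_vec v = 2 ^ m"
  shows "measure_prob (query_mat m X *\<^sub>v v) (\<lambda>_. True) = measure_prob v (\<lambda>_. True)"
proof -
  have d: "dim_vec (query_mat m X *\<^sub>v v) = 2 ^ m" by (simp add: query_mat_def)
  show ?thesis
    unfolding measure_prob_def d assms(2)
    by (rule sum.reindex_bij_witness[where i = "query_index m X" and j = "query_index m X"])
       (use assms in \<open>auto simp: query_index_less query_index_query_index index_query_mat_mult\<close>)
qed

lemma dim_network_state:
  assumes "quantum_network N T m U" and "t \<le> T"
  shows "dim_vec (network_state m U X t) = 2 ^ m"
  using assms by (cases t) (auto simp: quantum_network_def unitary_mat_def)

lemma measure_prob_unit_vec:
  assumes "i < d"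
  shows "measure_prob (unit_vec d i) P = of_bool (P i)"
proof -
  have "measure_prob (unit_vec d i) P = (\<Sum>k | k < dim_vec (unit_vec d i :: complex vec) \<and> P k. if k = i then 1 else (0::real))"
    unfolding measure_prob_def using assms by (intro sum.cong) auto
  thus ?thesis using assms by simp
qed

text \<open>This turns a bound on the probability of one outcome into one on the complementary
  outcome.\<close>

lemma measure_prob_True_network_state:
  assumes "quantum_network N T m U" and "length X = N" and "t \<le> T"
  shows "measure_prob (network_state m U X t) (\<lambda>_. True) = 1"
  using assms(3)
proof (induction t)
  case 0
  have "measure_prob (unit_vec (2 ^ m) 0) (\<lambda>_. True) = 1"
    by (simp add: measure_prob_unit_vec)
  thus ?case
    using assms(1) measure_prob_True_unitary[of "2 ^ m" "U 0" "unit_vec (2 ^ m) 0"]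
    by (simp add: quantum_network_def)
next
  case (Suc t)
  have "unitary_mat (2 ^ m) (U (Suc t))" "ceillog2 (length X) + 1 \<le> m"
    using assms Suc.prems by (auto simp: quantum_network_def)
  thus ?case
    using Suc dim_network_state[OF assms(1), of t X]
    by (simp add: measure_prob_True_unitary measure_prob_True_query dim_query_mat)
qed

lemma measure_prob_split:
  "measure_prob v P + measure_prob v (\<lambda>k. \<not> P k) = measure_prob v (\<lambda>_. True)"
proof -
  have "measure_prob v (\<lambda>_. True) =
      (\<Sum>k\<in>{k. k < dim_vec v \<and> P k} \<union> {k. k < dim_vec v \<and> \<not> P k}. (cmod (v $ k))\<^sup>2)"
    unfolding measure_prob_def by (rule sum.cong) auto
  also have "\<dots> = measure_prob v P + measure_prob v (\<lambda>k. \<not> P k)"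
    unfolding measure_prob_def by (rule sum.union_disjoint) auto
  finally show ?thesis by simp
qed

lemma measure_prob_eq_0_iff:
  "measure_prob v P = 0 \<longleftrightarrow> (\<forall>k < dim_vec v. P k \<longrightarrow> v $ k = 0)"
  unfolding measure_prob_def by (subst sum_nonneg_eq_0_iff) auto

section \<open>The lower bound\<close>

text \<open>The character (-1)^w, where w is the number of ones in X; complex, so that it can be
  paired with amplitudes.\<close>

definition parity_sign :: "bool list \<Rightarrow> complex" where
  "parity_sign X = (\<Prod>j<length X. if X ! j then - 1 else 1)"

lemma parity_sign_flip:
  assumes "i < length X"
  shows "parity_sign (X[i := \<not> X ! i]) = - parity_sign X"
proof -
  have split: "parity_sign Y = (if Y ! i then - 1 else 1) *
      (\<Prod>j\<in>{..<length X} - {i}. if Y ! j then - 1 else 1)" if "length Y = length X" for Y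
    unfolding parity_sign_def that by (rule prod.remove) (use assms in auto)
  have "(\<Prod>j\<in>{..<length X} - {i}. if X[i := \<not> X ! i] ! j then - 1 else 1) =
      (\<Prod>j\<in>{..<length X} - {i}. if X ! j then - 1 else (1 :: complex))"
    by (intro prod.cong) auto
  thus ?thesis
    using assms by (simp add: split)
qed

lemma parity_sign_neq_0: "parity_sign X \<noteq> 0"
  by (simp add: parity_sign_def)

text \<open>Flipping coordinate i is an involution on the inputs that negates every term, so the sum
  equals its own negative.\<close>

lemma sum_parity_sign_independent:
  assumes "i < N" and "\<And>X. length X = N \<Longrightarrow> g (X[i := \<not> X ! i]) = g X"
  shows "(\<Sum>X | length X = N. parity_sign X * g X) = 0"
proof -
  have "(\<Sum>X | length X = N. parity_sign X * g X) = (\<Sum>X | length X = N. - (parity_sign X * g X))"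
    by (rule sum.reindex_bij_witness[where i = "\<lambda>X. X[i := \<not> X ! i]" and j = "\<lambda>X. X[i := \<not> X ! i]"])
       (use assms in \<open>auto simp: parity_sign_flip\<close>)
  thus ?thesis by (simp add: sum_negf)
qed

text \<open>The degree bound without polynomials as objects: \<open>S\<close> stands for the
  monomial of the x_i with i in \<open>S\<close>. Undoing one query may add one element to
  \<open>S\<close>, so \<open>card S + t\<close> stays below N along the induction.\<close>

lemma sum_parity_sign_network_state:
  assumes "quantum_network N T m U" and "t \<le> T" and "S \<subseteq> {..<N}" and "card S + t < N"
    and "k < 2 ^ m"
  shows "(\<Sum>X | length X = N. parity_sign X *
           (of_bool (\<forall>i\<in>S. X ! i) * network_state m U X t $ k)) = 0"
  using assms(2-)
proof (induction t arbitrary: S k)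
  case 0
  \<comment> \<open>Before any query the amplitude does not depend on X, and some variable is
    missing from the monomial.\<close>
  obtain i where i: "i < N" "i \<notin> S"
  proof -
    have "S \<noteq> {..<N}" using 0 by auto
    thus ?thesis using 0 that by auto
  qed
  show ?case
    by (rule sum_parity_sign_independent[OF i(1)])
       (use i in \<open>auto simp: nth_list_update intro!: arg_cong[of _ _ of_bool]\<close>)
next
  case (Suc t)
  let ?n = "ceillog2 N"
  define M where "M S X = (of_bool (\<forall>i\<in>S. X ! i) :: complex)" for S :: "nat set" and X
  have m: "?n + 1 \<le> m" and U: "U (Suc t) \<in> carrier_mat (2 ^ m) (2 ^ m)"
    using assms(1) Suc.prems by (auto simp: quantum_network_def unitary_mat_def)
  note dim = dim_network_state[OF assms(1), of t]
  have IH: "(\<Sum>X | length X = N. parity_sign X * (M S X * network_state m U X t $ k)) = 0"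
    if "S \<subseteq> {..<N}" "card S + t < N" "k < 2 ^ m" for S k
    unfolding M_def by (rule Suc.IH) (use that Suc.prems in auto)
  have query: "(\<Sum>X | length X = N. parity_sign X *
      (M S X * (query_mat m X *\<^sub>v network_state m U X t) $ c)) = 0" if c: "c < 2 ^ m" for c
  proof -
    define i where "i = drop_bit (m - ?n) c"
    define c' where "c' = flip_bit (m - ?n - 1) c"
    have eq: "(query_mat m X *\<^sub>v network_state m U X t) $ c =
        (if i < N \<and> X ! i then network_state m U X t $ c' else network_state m U X t $ c)"
      if "length X = N" for X
      using m c that dim Suc.prems
      by (subst index_query_mat_mult) (auto simp: query_index_def Let_def i_def c'_def)
    show ?thesis
    proof (cases "i < N")
      case False
      thus ?thesis using IH[of S c] Suc.prems c by (simp add: eq)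
    next
      case True
      \<comment> \<open>On the all-ones input the query does send c to \<open>c'\<close>, so the
        range bound for queries applies.\<close>
      have c': "c' < 2 ^ m"
        using query_index_less[of "replicate N True" m c] m c True
        by (simp add: query_index_def Let_def i_def c'_def)
      have fin: "finite S" using Suc.prems finite_subset by blast
      have card: "card (insert i S) + t < N"
        using Suc.prems card_insert_le_m1[of "Suc (card S)" S i] by simp
      \<comment> \<open>The amplitude v_c becomes v_c + x_i (v_c' - v_c), and x_i times the monomial
        of \<open>S\<close> is the monomial of \<open>insert i S\<close>.\<close>
      have "(\<Sum>X | length X = N. parity_sign X *
          (M S X * (query_mat m X *\<^sub>v network_state m U X t) $ c))
        = (\<Sum>X | length X = N. parity_sign X * (M S X * network_state m U X t $ c)
            + parity_sign X * (M (insert i S) X * network_state m U X t $ c')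
            - parity_sign X * (M (insert i S) X * network_state m U X t $ c))"
        using True by (intro sum.cong) (auto simp: eq M_def)
      thus ?thesis
        using True Suc.prems card c c'
        by (simp add: sum.distrib sum_subtractf IH)
    qed
  qed
  have step: "network_state m U X (Suc t) $ k = (\<Sum>c\<in>{0..<2 ^ m}. U (Suc t) $$ (k, c) *
      (query_mat m X *\<^sub>v network_state m U X t) $ c)" for X
  proof -
    have "network_state m U X (Suc t) $ k
        = row (U (Suc t)) k \<bullet> (query_mat m X *\<^sub>v network_state m U X t)"
      unfolding network_state.simps by (rule index_mult_mat_vec(1)) (use U Suc.prems in auto)
    also have "\<dots> = (\<Sum>c\<in>{0..<2 ^ m}. U (Suc t) $$ (k, c) *
      (query_mat m X *\<^sub>v network_state m U X t) $ c)"
      unfolding scalar_prod_def dim_mult_mat_vec dim_query_mat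
      by (intro sum.cong refl) (use U Suc.prems in simp)
    finally show ?thesis .
  qed
  \<comment> \<open>The entries of \<open>U (Suc t)\<close> do not depend on X, so the pairing
    passes through the linear map.\<close>
  have "(\<Sum>X | length X = N. parity_sign X * (M S X * network_state m U X (Suc t) $ k))
      = (\<Sum>X | length X = N. \<Sum>c\<in>{0..<2 ^ m}. U (Suc t) $$ (k, c) * (parity_sign X *
          (M S X * (query_mat m X *\<^sub>v network_state m U X t) $ c)))"
    by (simp only: step sum_distrib_left mult.left_commute)
  also have "\<dots> = (\<Sum>c\<in>{0..<2 ^ m}. U (Suc t) $$ (k, c) * (\<Sum>X | length X = N. parity_sign X *
          (M S X * (query_mat m X *\<^sub>v network_state m U X t) $ c)))"
    by (subst sum.swap) (simp add: sum_distrib_left)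
  also have "\<dots> = 0" by (simp add: query)
  finally show ?case by (simp add: M_def)
qed

text \<open>Only the all-ones input contributes to the pairing, with a non-zero term; for T below N
  the case \<open>S = {}\<close> would make the pairing vanish.\<close>

lemma amplitude_only_at_True_imp_le:
  assumes "quantum_network N T m U" and "k < 2 ^ m"
    and "network_state m U (replicate N True) T $ k \<noteq> 0"
    and "\<And>X. length X = N \<Longrightarrow> \<not> AND X \<Longrightarrow> network_state m U X T $ k = 0"
  shows "N \<le> T"
proof (rule ccontr)
  assume "\<not> N \<le> T"
  hence "(\<Sum>X | length X = N. parity_sign X * network_state m U X T $ k) = 0"
    using sum_parity_sign_network_state[OF assms(1) order_refl, of "{}" k] assms(2) by simp
  moreover have "(\<Sum>X | length X = N. parity_sign X * network_state m U X T $ k)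
      = (\<Sum>X\<in>{replicate N True}. parity_sign X * network_state m U X T $ k)"
  proof (rule sum.mono_neutral_right)
    show "finite {X :: bool list. length X = N}"
      using finite_lists_length_eq[of "UNIV :: bool set" N] by simp
    show "\<forall>X\<in>{X. length X = N} - {replicate N True}. parity_sign X * network_state m U X T $ k = 0"
    proof
      fix X assume X: "X \<in> {X. length X = N} - {replicate N True}"
      hence "\<not> AND X" by (auto simp: AND_def list_eq_iff_nth_eq)
      thus "parity_sign X * network_state m U X T $ k = 0" using X assms(4) by simp
    qed
  qed auto
  ultimately show False using assms(3) parity_sign_neq_0 by simp
qed

lemma computes_exactly_AND_imp_le:
  assumes "quantum_network N T m U" and "computes_exactly N T m U AND"
  shows "N \<le> T"
proof -
  let ?s = "\<lambda>X. network_state m U X T"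
  have AND1: "AND (replicate N True)" by (simp add: AND_def)
  have exact: "measure_prob (?s X) (\<lambda>k. bit k 0 = AND X) = 1" if "length X = N" for X
    using assms(2) that by (simp add: computes_exactly_def)
  note dim = dim_network_state[OF assms(1) order_refl]
  have "measure_prob (?s (replicate N True)) (\<lambda>k. bit k 0) \<noteq> 0"
    using exact[of "replicate N True"] AND1 by simp
  then obtain k where k: "k < 2 ^ m" "bit k 0" "?s (replicate N True) $ k \<noteq> 0"
    unfolding measure_prob_eq_0_iff using dim by auto
  \<comment> \<open>On every other input output 0 is certain, so total probability 1 leaves nothing
    for states with last bit 1.\<close>
  have "?s X $ k = 0" if X: "length X = N" "\<not> AND X" for X
  proof -
    have "measure_prob (?s X) (\<lambda>k. \<not> bit k 0) = 1"
      using exact[OF X(1)] X(2) by simp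
    moreover have "measure_prob (?s X) (\<lambda>_. True) = 1"
      by (rule measure_prob_True_network_state[OF assms(1) X(1) order_refl])
    ultimately have "measure_prob (?s X) (\<lambda>k. bit k 0) = 0"
      using measure_prob_split[of "?s X" "\<lambda>k. bit k 0"] by simp
    thus ?thesis using k dim unfolding measure_prob_eq_0_iff by auto
  qed
  with amplitude_only_at_True_imp_le[OF assms(1) k(1,3)] show ?thesis by blast
qed

lemma computes_zero_error_AND_imp_le:
  assumes "quantum_network N T m U" and "computes_zero_error N T m U AND"
  shows "N \<le> T"
proof -
  let ?s = "\<lambda>X. network_state m U X T"
  have AND1: "AND (replicate N True)" by (simp add: AND_def)
  note dim = dim_network_state[OF assms(1) order_refl]
  have zero: "?s X $ k = 0" if "length X = N" "k < 2 ^ m" "bit k 1" "bit k 0 \<noteq> AND X" for X k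
    using assms(2) that dim unfolding computes_zero_error_def measure_prob_eq_0_iff by metis
  let ?v = "?s (replicate N True)"
  have "measure_prob ?v (\<lambda>k. \<not> bit k 1) < 1 / 2"
    using assms(2) unfolding computes_zero_error_def by simp
  moreover have "measure_prob ?v (\<lambda>_. True) = 1"
    using measure_prob_True_network_state[OF assms(1) _ order_refl] by simp
  ultimately have "measure_prob ?v (\<lambda>k. bit k 1) \<noteq> 0"
    using measure_prob_split[of ?v "\<lambda>k. bit k 1"] by linarith
  then obtain k where k: "k < 2 ^ m" "bit k 1" "?v $ k \<noteq> 0"
    unfolding measure_prob_eq_0_iff using dim by auto
  \<comment> \<open>A conclusive state reached on the all-ones input must answer 1. On any other
    input that answer would be an error, so the amplitude is 0 there.\<close>
  have "bit k 0" using zero[of "replicate N True" k] k AND1 by auto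
  hence "?s X $ k = 0" if "length X = N" "\<not> AND X" for X
    using zero that k by blast
  with amplitude_only_at_True_imp_le[OF assms(1) k(1,3)] show ?thesis by blast
qed

section \<open>The upper bound\<close>

definition perm_mat :: "nat \<Rightarrow> (nat \<Rightarrow> nat) \<Rightarrow> complex mat" where
  "perm_mat d p = mat d d (\<lambda>(r, c). of_bool (r = p c))"

lemma perm_mat_mult_unit_vec:
  assumes "c < d" and "p c < d"
  shows "perm_mat d p *\<^sub>v unit_vec d c = unit_vec d (p c)"
  using assms by (intro eq_vecI) (auto simp: perm_mat_def)

lemma unitary_perm_mat:
  assumes "p permutes {..<d}"
  shows "unitary_mat d (perm_mat d p)"
proof -
  have less: "p i < d \<longleftrightarrow> i < d" for i using permutes_in_image[OF assms, of i] by simp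
  have inj: "p i = p j \<longleftrightarrow> i = j" for i j using permutes_inj[OF assms] by (auto dest: injD)
  have inv: "j = p i \<longleftrightarrow> i = inv_into UNIV p j" for i j using permutes_inverses[OF assms] by metis
  have inv_inj: "inv_into UNIV p i = inv_into UNIV p j \<longleftrightarrow> i = j" for i j
    using permutes_inj[OF permutes_inv[OF assms]] by (auto dest: injD)
  have inv_less: "inv_into UNIV p i < d" if "i < d" for i
    using permutes_in_image[OF permutes_inv[OF assms], of i] that by simp
  have carrier: "perm_mat d p \<in> carrier_mat d d" by (simp add: perm_mat_def)
  have dims: "dim_row (mat_adjoint (perm_mat d p)) = d" "dim_col (mat_adjoint (perm_mat d p)) = d"
    by (simp_all add: perm_mat_def dim_mat_adjoint)
  have "mat_adjoint (perm_mat d p) * perm_mat d p = 1\<^sub>m d"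
  proof (rule eq_matI)
    fix i j assume "i < dim_row (1\<^sub>m d :: complex mat)" "j < dim_col (1\<^sub>m d :: complex mat)"
    hence ij: "i < d" "j < d" by auto
    have "(mat_adjoint (perm_mat d p) * perm_mat d p) $$ (i, j)
        = (\<Sum>k\<in>{0..<d}. mat_adjoint (perm_mat d p) $$ (i, k) * perm_mat d p $$ (k, j))"
      using ij dims carrier by (simp add: scalar_prod_def)
    \<comment> \<open>Entries (k, i) and (k, j) are both 1 only for k = p i = p j, and injectivity
      then gives i = j.\<close>
    also have "\<dots> = (\<Sum>k\<in>{0..<d}. if k = p i then of_bool (i = j) else 0)"
      using ij by (intro sum.cong) (auto simp: index_mat_adjoint[OF carrier], auto simp: perm_mat_def inj)
    also have "\<dots> = 1\<^sub>m d $$ (i, j)" using ij less by simp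
    finally show "(mat_adjoint (perm_mat d p) * perm_mat d p) $$ (i, j) = 1\<^sub>m d $$ (i, j)" .
  qed (use dims carrier in auto)
  moreover have "perm_mat d p * mat_adjoint (perm_mat d p) = 1\<^sub>m d"
  proof (rule eq_matI)
    fix i j assume "i < dim_row (1\<^sub>m d :: complex mat)" "j < dim_col (1\<^sub>m d :: complex mat)"
    hence ij: "i < d" "j < d" by auto
    have "(perm_mat d p * mat_adjoint (perm_mat d p)) $$ (i, j)
        = (\<Sum>k\<in>{0..<d}. perm_mat d p $$ (i, k) * mat_adjoint (perm_mat d p) $$ (k, j))"
      using ij dims carrier by (simp add: scalar_prod_def)
    also have "\<dots> = (\<Sum>k\<in>{0..<d}. if k = inv_into UNIV p i then of_bool (i = j) else 0)"
      using ij
      by (intro sum.cong) (auto simp: index_mat_adjoint[OF carrier], auto simp: perm_mat_def inv inv_inj)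
    also have "\<dots> = 1\<^sub>m d $$ (i, j)" using ij inv_less by simp
    finally show "(perm_mat d p * mat_adjoint (perm_mat d p)) $$ (i, j) = 1\<^sub>m d $$ (i, j)" .
  qed (use dims carrier in auto)
  ultimately show ?thesis using carrier by (simp add: unitary_mat_def)
qed

text \<open>The workspace \<open>z\<close> has two bits, so that \<open>|i,b,z\<rangle>\<close> has index \<open>8 i + 4 b + z\<close>. The left
  bit of \<open>z\<close> is always 1; the right bit is 1 as long as only ones have been read, in which case
  \<open>i\<close> is the next position to query and \<open>b = 0\<close>. After a zero has been read at position \<open>s\<close>,
  the network stays at \<open>i = s\<close> with \<open>z = 2\<close>, and further queries only change \<open>b\<close>. The remainder
  modulo \<open>N\<close> keeps \<open>i\<close> in range after the last query.\<close>

fun and_perm :: "nat \<Rightarrow> nat \<Rightarrow> nat \<Rightarrow> nat" where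
  "and_perm N 0 = Transposition.transpose 0 3"
| "and_perm N (Suc t) =
     Transposition.transpose (8 * t + 7) (8 * (Suc t mod N) + 3) \<circ>
     Transposition.transpose (8 * t + 3) (8 * t + 2)"

text \<open>The classical run: the index of the basis state reached after t queries and the unitary
  following them. The first transposition sends 0 to 3, which is i = 0, b = 0, z = 3.\<close>

fun and_index :: "nat \<Rightarrow> bool list \<Rightarrow> nat \<Rightarrow> nat" where
  "and_index m X 0 = 3"
| "and_index m X (Suc t) = and_perm (length X) (Suc t) (query_index m X (and_index m X t))"

lemma and_perm_permutes:
  assumes "t \<le> N" and "N \<ge> 1"
  shows "and_perm N t permutes {..<2 ^ (ceillog2 N + 3)}"
proof -
  have less: "8 * s + j < 2 ^ (ceillog2 N + 3)" if "s < N" "j < 8" for s j :: nat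
    using le_two_power_ceillog2[of N] that by (simp add: power_add)
  show ?thesis
  proof (cases t)
    case 0
    thus ?thesis using less[of 0 0] less[of 0 3] assms by (auto intro: permutes_swap_id)
  next
    case (Suc s)
    have "Suc s mod N < N" using assms by simp
    thus ?thesis
      unfolding Suc and_perm.simps
      by (intro permutes_compose permutes_swap_id)
         (use less[of s 7] less[of s 3] less[of s 2] less[of "Suc s mod N" 3] assms Suc in auto)
  qed
qed

text \<open>With two bits in z, the query bit is bit 2 and i is the quotient by 8; j and j' carry
  the same z with b = 0 and b = 1.\<close>

lemma query_index_8:
  assumes "s < length X" and "j < 4" and "j' = j + 4"
  defines "q \<equiv> query_index (ceillog2 (length X) + 3) X"
  shows "q (8 * s + j) = (if X ! s then 8 * s + j' else 8 * s + j)"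
    and "q (8 * s + j') = (if X ! s then 8 * s + j else 8 * s + j')"
proof -
  have drop: "drop_bit 3 (8 * s + j) = s" "drop_bit 3 (8 * s + j') = s"
    using assms(2,3) by (simp_all add: drop_bit_eq_div)
  have "(8 * s + j) div 4 = 2 * s"
    using assms(2) by linarith
  hence flip: "flip_bit 2 (8 * s + j) = 8 * s + j'"
    using assms(3) by (simp add: flip_bit_eq_if set_bit_eq bit_iff_odd)
  have "flip_bit 2 (flip_bit 2 (8 * s + j)) = 8 * s + j"
    by (rule bit_eqI) (auto simp: bit_flip_bit_iff)
  hence "flip_bit 2 (8 * s + j') = 8 * s + j" by (simp only: flip)
  with flip show "q (8 * s + j) = (if X ! s then 8 * s + j' else 8 * s + j)"
    "q (8 * s + j') = (if X ! s then 8 * s + j else 8 * s + j')"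
    using drop assms(1) by (simp_all add: q_def query_index_def Let_def)
qed

lemma and_index_invariant:
  assumes "length X = N" and "N \<ge> 1" and "t \<le> N"
  shows "if \<forall>j<t. X ! j then and_index (ceillog2 N + 3) X t = 8 * (t mod N) + 3
         else \<exists>s<t. and_index (ceillog2 N + 3) X t \<in> {8 * s + 2, 8 * s + 6}"
  using assms(3)
proof (induction t)
  case 0
  thus ?case by simp
next
  case (Suc t)
  note query = query_index_8[of _ X, unfolded assms(1)]
  show ?case
  proof (cases "\<forall>j<t. X ! j")
    case True
    \<comment> \<open>Here t is below N, so \<open>t mod N\<close> is t.\<close>
    hence "and_index (ceillog2 N + 3) X t = 8 * t + 3" using Suc by simp
    moreover have "query_index (ceillog2 N + 3) X (8 * t + 3)
        = (if X ! t then 8 * t + 7 else 8 * t + 3)"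
      using query(1)[of t 3 7] Suc.prems by simp
    ultimately have eq: "and_index (ceillog2 N + 3) X (Suc t)
        = and_perm N (Suc t) (if X ! t then 8 * t + 7 else 8 * t + 3)"
      using assms(1) by (simp del: and_perm.simps)
    show ?thesis
    proof (cases "X ! t")
      case X: True
      have "\<forall>j<Suc t. X ! j" using True X by (auto simp: less_Suc_eq)
      \<comment> \<open>The transposition applied first misses the state with b = 1; the other one
        clears b and advances i.\<close>
      moreover have "and_index (ceillog2 N + 3) X (Suc t) = 8 * (Suc t mod N) + 3"
        unfolding eq using X by (simp add: Transposition.transpose_def)
      ultimately show ?thesis by simp
    next
      case X: False
      \<comment> \<open>Residues modulo 8 keep 8 t + 2 from being moved again by the transposition
        applied last.\<close>
      have "8 * a + 2 \<noteq> 8 * b + 3" for a b :: nat by presburger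
      hence "and_index (ceillog2 N + 3) X (Suc t) = 8 * t + 2"
        unfolding eq using X by (simp add: Transposition.transpose_def)
      thus ?thesis using X by auto
    qed
  next
    case False
    then obtain s where s: "s < t" "and_index (ceillog2 N + 3) X t \<in> {8 * s + 2, 8 * s + 6}"
      using Suc.IH Suc.prems by (simp only: if_False Suc_leD) blast
    define k where "k = query_index (ceillog2 N + 3) X (and_index (ceillog2 N + 3) X t)"
    \<comment> \<open>The invariant does not record the value of \<open>X ! s\<close>, so both
      values of b are allowed.\<close>
    have k: "k = 8 * s + 2 \<or> k = 8 * s + 6"
      using s query[of s 2 6] Suc.prems by (cases "X ! s") (auto simp: k_def)
    \<comment> \<open>Residues modulo 8, together with s below t, keep k away from all indices that
      the two transpositions move.\<close>
    hence "k \<noteq> 8 * b + 3" for b by presburger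
    moreover have "k \<noteq> 8 * t + 2" "k \<noteq> 8 * t + 7" using k s(1) by presburger+
    ultimately have "and_perm N (Suc t) k = k"
      by (simp add: transpose_apply_other)
    hence "and_index (ceillog2 N + 3) X (Suc t) \<in> {8 * s + 2, 8 * s + 6}"
      using k assms(1) by (simp add: k_def del: and_perm.simps)
    moreover have "\<not> (\<forall>j<Suc t. X ! j)" using False less_SucI by blast
    ultimately show ?thesis using less_SucI[OF s(1)] by (simp only: if_False) blast
  qed
qed

lemma network_state_and_perm:
  assumes "length X = N" and "N \<ge> 1" and "t \<le> N"
  defines "m \<equiv> ceillog2 N + 3"
  shows "and_index m X t < 2 ^ m \<and>
    network_state m (\<lambda>t. perm_mat (2 ^ m) (and_perm N t)) X t = unit_vec (2 ^ m) (and_index m X t)"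
  using assms(3)
proof (induction t)
  case 0
  have "(3::nat) < 2 ^ m" by (simp add: m_def power_add less_le_trans[of 3 8])
  thus ?case by (simp add: perm_mat_mult_unit_vec)
next
  case (Suc t)
  have q: "query_index m X (and_index m X t) < 2 ^ m"
    using Suc assms by (intro query_index_less) auto
  have "and_index m X (Suc t) < 2 ^ m"
    using permutes_in_image[OF and_perm_permutes[OF Suc.prems assms(2)]] q assms(1)
    by (simp add: m_def del: and_perm.simps)
  \<comment> \<open>The matrix \<open>query_mat m X\<close> is \<open>perm_mat\<close> for
    \<open>query_index m X\<close>.\<close>
  moreover have "query_mat m X *\<^sub>v unit_vec (2 ^ m) (and_index m X t)
      = unit_vec (2 ^ m) (query_index m X (and_index m X t))"
    using Suc q perm_mat_mult_unit_vec[of "and_index m X t" "2 ^ m" "query_index m X"]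
    by (simp add: perm_mat_def query_mat_def)
  ultimately show ?case
    using Suc q assms(1) by (simp add: perm_mat_mult_unit_vec del: and_perm.simps)
qed

text \<open>One network serves both notions: it ends in a basis state with bit 1 set, so it is never
  inconclusive.\<close>

lemma network_for_AND:
  assumes "N \<ge> 1"
  obtains m U where "quantum_network N N m U" and "computes_exactly N N m U AND"
    and "computes_zero_error N N m U AND"
proof -
  define m where "m = ceillog2 N + 3"
  define U where "U = (\<lambda>t. perm_mat (2 ^ m) (and_perm N t))"
  have final: "\<exists>i<2 ^ m. network_state m U X N = unit_vec (2 ^ m) i \<and> bit i 1 \<and> bit i 0 = AND X"
    if X: "length X = N" for X
  proof -
    let ?i = "and_index m X N"
    have i: "?i < 2 ^ m" "network_state m U X N = unit_vec (2 ^ m) ?i"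
      using network_state_and_perm[OF X assms order_refl] by (auto simp: m_def U_def)
    \<comment> \<open>Since \<open>N mod N = 0\<close>, the all-ones input ends at 3. Both 8 s + 2
      and 8 s + 6 have bit 1 set and bit 0 clear.\<close>
    have "(if AND X then ?i = 3 else \<exists>s. ?i = 8 * s + 2 \<or> ?i = 8 * s + 6)"
      using and_index_invariant[OF X assms order_refl] by (auto simp: AND_def X m_def split: if_splits)
    hence "bit ?i 1 \<and> bit ?i 0 = AND X"
      by (auto simp: bit_iff_odd split: if_splits)
    with i show ?thesis by blast
  qed
  show ?thesis
  proof
    show "quantum_network N N m U"
      using and_perm_permutes[OF _ assms]
      by (auto simp: quantum_network_def m_def U_def intro!: unitary_perm_mat)
    show "computes_exactly N N m U AND"
      unfolding computes_exactly_def
    proof (intro allI impI)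
      fix X :: "bool list" assume "length X = N"
      from final[OF this] show "measure_prob (network_state m U X N) (\<lambda>k. bit k 0 = AND X) = 1"
        by (auto simp: measure_prob_unit_vec)
    qed
    show "computes_zero_error N N m U AND"
      unfolding computes_zero_error_def
    proof (intro conjI allI impI)
      show "2 \<le> m" by (simp add: m_def)
      fix X :: "bool list" assume "length X = N"
      note * = final[OF this]
      from * show "measure_prob (network_state m U X N) (\<lambda>k. bit k 1 \<and> bit k 0 \<noteq> AND X) = 0"
        by (auto simp: measure_prob_unit_vec)
      from * show "measure_prob (network_state m U X N) (\<lambda>k. \<not> bit k 1) < 1 / 2"
        by (auto simp: measure_prob_unit_vec)
    qed
  qed
qed

theorem mainTheorem10:
  fixes N :: nat
  assumes "N \<ge> 1"
  shows "Q_E N AND = enat N \<and> Q_0 N AND = enat N"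
proof -
  obtain m U where U: "quantum_network N N m U" "computes_exactly N N m U AND"
    "computes_zero_error N N m U AND"
    using network_for_AND[OF assms] .
  show ?thesis
  proof
    show "Q_E N AND = enat N"
      unfolding Q_E_def
      by (intro antisym INF_lower2[of N] INF_greatest)
         (use U computes_exactly_AND_imp_le in auto)
    show "Q_0 N AND = enat N"
      unfolding Q_0_def
      by (intro antisym INF_lower2[of N] INF_greatest)
         (use U computes_zero_error_AND_imp_le in auto)
  qed
qed

end
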